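(* $[\mathcal{R}\mathbf{Txt}\mathbf{It}\mathbf{CInd}\mathbf{Ex}_C]_{\mathbf{REC}} \subsetneq [\mathbf{Txt}\mathbf{It}\mathbf{CInd}\mathbf{Ex}_C]_{\mathbf{REC}}$.
   Context: Fix an acceptable numbering $(\varphi_e)_{e\in\mathbb{N}}$ of all partial computable functions. A number $e$ is a $C$-index if $\varphi_e$ is total with values in $\{0,1\}$; then $C_e=\{x:\varphi_e(x)=1\}$. $\mathbf{REC}$ is the collection of recursive subsets of $\mathbb{N}$; $\mathcal{P}$ and $\mathcal{R}$ are the partial computable and total computable functions. Fix a pause symbol $\#$. A text is a total function $T:\mathbb{N}\to\mathbb{N}\cup\{\#\}$, $\mathrm{content}(T)=\mathrm{range}(T)\setminus\{\#\}$, $T$ is a text for $L$ if $\mathrm{content}(T)=L$. A learner is some $h\in\mathcal{P}$. Iterative hypothesis sequence: $\mathbf{It}(h,T)(0)=h(\varepsilon)$ ($\varepsilon$ the empty sequence) and $\mathbf{It}(h,T)(i)=h(\mathbf{It}(h,T)(i-1),T(i-1))$ for $i>0$. Restrictions on a hypothesis sequence $p$ and text $T$: $\mathbf{Ex}_C$: there is $n_0$ with $p(n)=p(n_0)$ for all $n\ge n_0$ and $p(n_0)$ a $C$-index with $C_{p(n_0)}=\mathrm{content}(T)$; $\mathbf{CInd}$: for all $i$, $p(i)$ is a $C$-index. Juxtaposition means conjunction. For $\mathcal{C}\in\{\mathcal{P},\mathcal{R}\}$ (omitted means $\mathcal{P}$), $h\in\mathcal{C}$ $\mathcal{C}\mathbf{Txt}\beta\delta$-learns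 $L$ iff $\delta(\beta(h,T),T)$ holds for every text $T$ for $L$; $[\mathcal{C}\mathbf{Txt}\beta\delta]_{\mathbf{REC}}$ is the set of all classes $\mathcal{L}\subseteq\mathbf{REC}$ for which some $h\in\mathcal{C}$ learns every $L\in\mathcal{L}$. *)

theory Defs
  imports Main "HOL-Library.Nat_Bijection"
begin

datatype recf =
    Zero
  | Succ
  | Proj nat
  | Comp recf "recf list"
  | PrimRec recf recf
  | Mu recf

inductive has_arity :: "recf \<Rightarrow> nat \<Rightarrow> bool" where
  "has_arity Zero n"
| "has_arity Succ 1"
| "i < n \<Longrightarrow> has_arity (Proj i) n"
| "has_arity f (length gs) \<Longrightarrow> (\<And>g. g \<in> set gs \<Longrightarrow> has_arity g n) \<Longrightarrow> has_arity (Comp f gs) n"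
| "has_arity f n \<Longrightarrow> has_arity g (Suc (Suc n)) \<Longrightarrow> has_arity (PrimRec f g) (Suc n)"
| "has_arity f (Suc n) \<Longrightarrow> has_arity (Mu f) n"

text \<open>\<^const>\<open>None\<close> stands for divergence. The recursion and minimisation variables come first in
  the argument list. Argument lists whose length is not an arity of the scheme get junk values,
  which \<open>partial_recursive\<close> below never looks at.\<close>

primrec eval :: "recf \<Rightarrow> nat list \<Rightarrow> nat option" where
  "eval Zero = (\<lambda>xs. Some 0)"
| "eval Succ = (\<lambda>xs. Some (Suc (hd xs)))"
| "eval (Proj i) = (\<lambda>xs. Some (xs ! i))"
| "eval (Comp f gs) = (\<lambda>xs.
     if \<forall>v \<in> set (map eval gs). v xs \<noteq> None
     then eval f (map (\<lambda>v. the (v xs)) (map eval gs))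
     else None)"
| "eval (PrimRec f g) = (\<lambda>xs.
     rec_nat (eval f (tl xs))
       (\<lambda>k r. case r of None \<Rightarrow> None | Some v \<Rightarrow> eval g (k # v # tl xs))
       (hd xs))"
| "eval (Mu f) = (\<lambda>xs.
     if \<exists>z. eval f (z # xs) = Some 0 \<and> (\<forall>y<z. eval f (y # xs) \<noteq> None)
     then Some (LEAST z. eval f (z # xs) = Some 0)
     else None)"

definition partial_recursive :: "nat \<Rightarrow> (nat list \<Rightarrow> nat option) \<Rightarrow> bool" where
  "partial_recursive n \<psi> \<longleftrightarrow>
     (\<exists>r. has_arity r n \<and> (\<forall>xs. length xs = n \<longrightarrow> eval r xs = \<psi> xs))"

definition partial_computable :: "(nat \<Rightarrow> nat option) \<Rightarrow> bool" where
  "partial_computable \<psi> \<longleftrightarrow> partial_recursive 1 (\<lambda>xs. \<psi> (xs ! 0))"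

definition partial_computable2 :: "(nat \<Rightarrow> nat \<Rightarrow> nat option) \<Rightarrow> bool" where
  "partial_computable2 \<psi> \<longleftrightarrow> partial_recursive 2 (\<lambda>xs. \<psi> (xs ! 0) (xs ! 1))"

definition total_computable :: "(nat \<Rightarrow> nat) \<Rightarrow> bool" where
  "total_computable f \<longleftrightarrow> partial_computable (\<lambda>x. Some (f x))"

definition REC :: "nat set set" where
  "REC = {A. total_computable (\<lambda>x. if x \<in> A then 1 else 0)}"

text \<open>Rogers' notion: a numbering of all unary partial computable functions whose universal
  function is partial computable and into which every partial computable family of unary functions
  translates effectively.\<close>

definition acceptable_numbering :: "(nat \<Rightarrow> nat \<Rightarrow> nat option) \<Rightarrow> bool" where
  "acceptable_numbering \<phi> \<longleftrightarrow>
     range \<phi> = {\<psi>. partial_computable \<psi>} \<and>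
     partial_computable2 \<phi> \<and>
     (\<forall>\<psi>. partial_computable2 \<psi> \<longrightarrow> (\<exists>s. total_computable s \<and> (\<forall>e. \<phi> (s e) = \<psi> e)))"

definition C_index :: "(nat \<Rightarrow> nat \<Rightarrow> nat option) \<Rightarrow> nat \<Rightarrow> bool" where
  "C_index \<phi> e \<longleftrightarrow> (\<forall>x. \<phi> e x \<in> {Some 0, Some 1})"

definition C_set :: "(nat \<Rightarrow> nat \<Rightarrow> nat option) \<Rightarrow> nat \<Rightarrow> nat set" where
  "C_set \<phi> e = {x. \<phi> e x = Some 1}"

text \<open>\<^const>\<open>None\<close> in a text is the pause symbol.\<close>

type_synonym text_seq = "nat \<Rightarrow> nat option"

definition content :: "text_seq \<Rightarrow> nat set" where
  "content T = {x. Some x \<in> range T}"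

definition text_for :: "text_seq \<Rightarrow> nat set \<Rightarrow> bool" where
  "text_for T L \<longleftrightarrow> content T = L"

text \<open>An iterative learner is applied to the empty sequence (\<open>Start\<close>) or to a pair of a hypothesis
  and a datum (\<open>Step\<close>). Computability of such a function refers to the bijective coding
  \<open>code_input\<close> of these arguments by natural numbers.\<close>

datatype learner_input = Start | Step nat "nat option"

type_synonym learner = "learner_input \<Rightarrow> nat option"

definition code_datum :: "nat option \<Rightarrow> nat" where
  "code_datum d = (case d of None \<Rightarrow> 0 | Some x \<Rightarrow> Suc x)"

definition code_input :: "learner_input \<Rightarrow> nat" where
  "code_input i = (case i of Start \<Rightarrow> 0 | Step e d \<Rightarrow> Suc (prod_encode (e, code_datum d)))"

lemma bij_code_input: "bij code_input"
proof (rule bijI)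
  show "inj code_input"
    by (auto simp: inj_on_def code_input_def code_datum_def split: learner_input.splits option.splits)
  have "\<exists>i. n = code_input i" for n
  proof (cases n)
    case 0
    then show ?thesis by (intro exI[of _ Start]) (simp add: code_input_def)
  next
    case (Suc m)
    obtain e c where m: "m = prod_encode (e, c)"
      by (metis prod_decode_inverse surj_pair)
    have "code_datum (case c of 0 \<Rightarrow> None | Suc x \<Rightarrow> Some x) = c"
      by (simp add: code_datum_def split: nat.split)
    then show ?thesis
      using Suc m
      by (intro exI[of _ "Step e (case c of 0 \<Rightarrow> None | Suc x \<Rightarrow> Some x)"])
        (simp add: code_input_def)
  qed
  then show "surj code_input" unfolding surj_def by blast
qed

definition partial_learners :: "learner set" where
  "partial_learners = {h. \<exists>\<psi>. partial_computable \<psi> \<and> (\<forall>i. h i = \<psi> (code_input i))}"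

definition total_learners :: "learner set" where
  "total_learners = {h \<in> partial_learners. \<forall>i. h i \<noteq> None}"

text \<open>A hypothesis sequence may be undefined (\<^const>\<open>None\<close>) from some point on.\<close>

type_synonym hyps = "nat \<Rightarrow> nat option"

primrec It :: "learner \<Rightarrow> text_seq \<Rightarrow> hyps" where
  "It h T 0 = h Start"
| "It h T (Suc i) = (case It h T i of None \<Rightarrow> None | Some e \<Rightarrow> h (Step e (T i)))"

definition Ex_C :: "(nat \<Rightarrow> nat \<Rightarrow> nat option) \<Rightarrow> hyps \<Rightarrow> text_seq \<Rightarrow> bool" where
  "Ex_C \<phi> p T \<longleftrightarrow>
     (\<exists>n\<^sub>0 e. p n\<^sub>0 = Some e \<and> (\<forall>n\<ge>n\<^sub>0. p n = p n\<^sub>0) \<and> C_index \<phi> e \<and> C_set \<phi> e = content T)"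

definition CInd :: "(nat \<Rightarrow> nat \<Rightarrow> nat option) \<Rightarrow> hyps \<Rightarrow> text_seq \<Rightarrow> bool" where
  "CInd \<phi> p T \<longleftrightarrow> (\<forall>i. \<exists>e. p i = Some e \<and> C_index \<phi> e)"

definition CIndEx_C :: "(nat \<Rightarrow> nat \<Rightarrow> nat option) \<Rightarrow> hyps \<Rightarrow> text_seq \<Rightarrow> bool" where
  "CIndEx_C \<phi> p T \<longleftrightarrow> CInd \<phi> p T \<and> Ex_C \<phi> p T"

definition learns ::
  "(learner \<Rightarrow> text_seq \<Rightarrow> hyps) \<Rightarrow> (hyps \<Rightarrow> text_seq \<Rightarrow> bool) \<Rightarrow> learner \<Rightarrow> nat set \<Rightarrow> bool" where
  "learns \<beta> \<delta> h L \<longleftrightarrow> (\<forall>T. text_for T L \<longrightarrow> \<delta> (\<beta> h T) T)"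

definition Txt_REC ::
  "learner set \<Rightarrow> (learner \<Rightarrow> text_seq \<Rightarrow> hyps) \<Rightarrow> (hyps \<Rightarrow> text_seq \<Rightarrow> bool) \<Rightarrow> nat set set set" where
  "Txt_REC \<C> \<beta> \<delta> = {\<L>. \<L> \<subseteq> REC \<and> (\<exists>h\<in>\<C>. \<forall>L\<in>\<L>. learns \<beta> \<delta> h L)}"

end

theory Submission imports Defs
begin

text \<open>
  Each datum \<open>item k i e\<close> names an index \<open>i\<close> of a learner and a state \<open>e\<close> of that learner. For a
  total \<open>\<phi> i\<close>, feed the learner \<open>i\<close> the items \<open>item k i e\<^sub>k\<close>, where \<open>e\<^sub>k\<close> is its state at time \<open>k\<close>,
  until it first fails to change its mind, and let \<open>B\<^sub>i\<close> be the set of all items fed and \<open>A\<^sub>i\<close> the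
  set of those that caused a mind change. If the learner changes its mind at every step, it does not
  converge on \<open>A\<^sub>i = B\<^sub>i\<close>; otherwise it ignores the single item in \<open>B\<^sub>i - A\<^sub>i\<close> and cannot tell \<open>A\<^sub>i\<close>
  from \<open>B\<^sub>i\<close>. A partial iterative learner can learn all of these sets: an item of \<open>B\<^sub>i\<close> lies in \<open>A\<^sub>i\<close>
  iff running \<open>\<phi> i\<close> on the state and item shows a mind change, and that run may diverge when \<open>\<phi> i\<close>
  is not total.
\<close>

section \<open>Closure properties of partial recursive functions\<close>

lemma partial_recursive_cong:
  assumes "partial_recursive n f" and "\<And>xs. length xs = n \<Longrightarrow> f xs = g xs"
  shows "partial_recursive n g"
  using assms unfolding partial_recursive_def by metis

text \<open>\<open>Comp\<close> evaluates strictly: one diverging argument makes the value diverge,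
  whatever \<open>g\<close> does with that argument. The conditional records this.\<close>

lemma partial_recursive_comp:
  assumes g: "partial_recursive (length fs) g"
    and fs: "\<And>f. f \<in> set fs \<Longrightarrow> partial_recursive n f"
  shows "partial_recursive n
    (\<lambda>xs. if \<forall>f \<in> set fs. f xs \<noteq> None then g (map (\<lambda>f. the (f xs)) fs) else None)"
proof -
  obtain r where r: "has_arity r (length fs)" "\<And>xs. length xs = length fs \<Longrightarrow> eval r xs = g xs"
    using g unfolding partial_recursive_def by blast
  have "\<forall>f. \<exists>s. f \<in> set fs \<longrightarrow>
      has_arity s n \<and> (\<forall>xs. length xs = n \<longrightarrow> eval s xs = f xs)"
    using fs unfolding partial_recursive_def by blast
  then obtain s where s: "\<And>f. f \<in> set fs \<Longrightarrow> has_arity (s f) n"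
    "\<And>f xs. f \<in> set fs \<Longrightarrow> length xs = n \<Longrightarrow> eval (s f) xs = f xs"
    by metis
  have "has_arity (Comp r (map s fs)) n"
    using r(1) s(1) by (intro has_arity.intros) auto
  moreover have "eval (Comp r (map s fs)) xs =
      (if \<forall>f \<in> set fs. f xs \<noteq> None then g (map (\<lambda>f. the (f xs)) fs) else None)"
    if "length xs = n" for xs
  proof -
    have "map (\<lambda>v. the (v xs)) (map eval (map s fs)) = map (\<lambda>f. the (f xs)) fs"
      using s(2) that by simp
    moreover have "(\<forall>v \<in> set (map eval (map s fs)). v xs \<noteq> None) \<longleftrightarrow>
        (\<forall>f \<in> set fs. f xs \<noteq> None)"
      using s(2) that by simp
    ultimately have "eval (Comp r (map s fs)) xs =
        (if \<forall>f \<in> set fs. f xs \<noteq> None then eval r (map (\<lambda>f. the (f xs)) fs) else None)"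
      by (simp only: eval.simps)
    then show ?thesis using r(2)[of "map (\<lambda>f. the (f xs)) fs"] by (simp only: length_map)
  qed
  ultimately show ?thesis unfolding partial_recursive_def by blast
qed

lemma partial_recursive_primrec:
  assumes f: "partial_recursive n f" and g: "partial_recursive (Suc (Suc n)) g" and n: "0 < n"
  shows "partial_recursive (Suc n)
    (\<lambda>xs. rec_nat (f (tl xs)) (\<lambda>k r. Option.bind r (\<lambda>v. g (k # v # tl xs))) (hd xs))"
proof -
  obtain r where r: "has_arity r n" "\<And>xs. length xs = n \<Longrightarrow> eval r xs = f xs"
    using f unfolding partial_recursive_def by blast
  obtain s where s: "has_arity s (Suc (Suc n))"
    "\<And>xs. length xs = Suc (Suc n) \<Longrightarrow> eval s xs = g xs"
    using g unfolding partial_recursive_def by blast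
  obtain m where m: "n = Suc m" using n by (cases n) auto
  have "has_arity (PrimRec r s) (Suc n)"
    using r(1) s(1) by (intro has_arity.intros)
  moreover have "eval (PrimRec r s) xs =
      rec_nat (f (tl xs)) (\<lambda>k r. Option.bind r (\<lambda>v. g (k # v # tl xs))) (hd xs)"
    if "length xs = Suc n" for xs
  proof -
    have "rec_nat (eval r (tl xs))
        (\<lambda>k r. case r of None \<Rightarrow> None | Some v \<Rightarrow> eval s (k # v # tl xs)) m =
      rec_nat (f (tl xs)) (\<lambda>k r. Option.bind r (\<lambda>v. g (k # v # tl xs))) m" for m
      using r(2) s(2) that by (induction m) (auto split: option.split)
    then show ?thesis by simp
  qed
  ultimately show ?thesis unfolding partial_recursive_def by blast
qed

lemma partial_recursive_least:
  assumes f: "partial_recursive (Suc n) (\<lambda>xs. Some (f xs))"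
    and ex: "\<And>xs. length xs = n \<Longrightarrow> \<exists>z. f (z # xs) = 0"
  shows "partial_recursive n (\<lambda>xs. Some (LEAST z. f (z # xs) = 0))"
proof -
  obtain r where r: "has_arity r (Suc n)" "\<And>xs. length xs = Suc n \<Longrightarrow> eval r xs = Some (f xs)"
    using f unfolding partial_recursive_def by blast
  have "has_arity (Mu r) n" using r(1) by (intro has_arity.intros)
  moreover have "eval (Mu r) xs = Some (LEAST z. f (z # xs) = 0)" if "length xs = n" for xs
    using r(2) ex[OF that] that by simp
  ultimately show ?thesis unfolding partial_recursive_def by blast
qed

abbreviation total_recursive :: "nat \<Rightarrow> (nat list \<Rightarrow> nat) \<Rightarrow> bool" where
  "total_recursive n f \<equiv> partial_recursive n (\<lambda>xs. Some (f xs))"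

lemma total_recursive_proj: "i < n \<Longrightarrow> total_recursive n (\<lambda>xs. xs ! i)"
  unfolding partial_recursive_def by (intro exI[of _ "Proj i"]) (simp add: has_arity.intros)

lemma partial_recursive_comp1:
  assumes "partial_recursive 1 g" "total_recursive n f"
  shows "partial_recursive n (\<lambda>xs. g [f xs])"
  by (rule partial_recursive_cong[OF partial_recursive_comp[where fs = "[\<lambda>xs. Some (f xs)]" and g = g]])
    (use assms in auto)

lemma partial_recursive_comp2:
  assumes "partial_recursive 2 g" "total_recursive n f\<^sub>1" "total_recursive n f\<^sub>2"
  shows "partial_recursive n (\<lambda>xs. g [f\<^sub>1 xs, f\<^sub>2 xs])"
  by (rule partial_recursive_cong[OF partial_recursive_comp
        [where fs = "[\<lambda>xs. Some (f\<^sub>1 xs), \<lambda>xs. Some (f\<^sub>2 xs)]" and g = g]])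
    (use assms in \<open>auto simp: numeral_2_eq_2\<close>)

lemma partial_recursive_comp3:
  assumes "partial_recursive 3 g" "total_recursive n f\<^sub>1" "total_recursive n f\<^sub>2"
    "total_recursive n f\<^sub>3"
  shows "partial_recursive n (\<lambda>xs. g [f\<^sub>1 xs, f\<^sub>2 xs, f\<^sub>3 xs])"
  by (rule partial_recursive_cong[OF partial_recursive_comp
        [where fs = "[\<lambda>xs. Some (f\<^sub>1 xs), \<lambda>xs. Some (f\<^sub>2 xs), \<lambda>xs. Some (f\<^sub>3 xs)]" and g = g]])
    (use assms in \<open>auto simp: numeral_3_eq_3\<close>)

text \<open>This is \<open>g\<close> composed with \<open>f\<close> and all projections; strictness
  of composition is the propagation of \<open>None\<close> by \<open>Option.bind\<close>. The bound
  value is put in front of the list, so that position \<open>i\<close> of \<open>xs\<close> is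
  position \<open>i + 1\<close> for \<open>g\<close>.\<close>

lemma partial_recursive_bind:
  assumes f: "partial_recursive n f" and g: "partial_recursive (Suc n) g"
    and h: "\<And>v xs. length xs = n \<Longrightarrow> h v xs = g (v # xs)"
  shows "partial_recursive n (\<lambda>xs. Option.bind (f xs) (\<lambda>v. h v xs))"
proof -
  let ?fs = "f # map (\<lambda>i xs. Some (xs ! i)) [0..<n]"
  have *: "partial_recursive n
     (\<lambda>xs. if \<forall>f \<in> set ?fs. f xs \<noteq> None then g (map (\<lambda>f. the (f xs)) ?fs) else None)"
    using f g by (intro partial_recursive_comp) (auto intro: total_recursive_proj)
  show ?thesis
  proof (rule partial_recursive_cong[OF *])
    fix xs :: "nat list" assume len: "length xs = n"
    then have "map (\<lambda>f. the (f xs)) (map (\<lambda>i xs. Some (xs ! i)) [0..<n]) = xs"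
      using map_nth[of xs] by (simp add: comp_def)
    then show "(if \<forall>f \<in> set ?fs. f xs \<noteq> None then g (map (\<lambda>f. the (f xs)) ?fs) else None) =
        Option.bind (f xs) (\<lambda>v. h v xs)"
      by (cases "f xs") (auto simp: comp_def h[OF len])
  qed
qed

lemma total_recursive_Suc:
  assumes "total_recursive n f" shows "total_recursive n (\<lambda>xs. Suc (f xs))"
proof -
  have "partial_recursive 1 (\<lambda>xs. Some (Suc (hd xs)))"
    unfolding partial_recursive_def by (intro exI[of _ Succ]) (use has_arity.intros(2) in simp)
  from partial_recursive_comp1[OF this assms] show ?thesis by simp
qed

lemma total_recursive_const: "total_recursive n (\<lambda>xs. k)"
proof (induction k)
  case 0
  show ?case unfolding partial_recursive_def
    by (intro exI[of _ Zero]) (simp add: has_arity.intros)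
next
  case (Suc k)
  then show ?case by (rule total_recursive_Suc)
qed

lemma total_recursive_primrec:
  assumes "total_recursive n f" "total_recursive (Suc (Suc n)) g" "0 < n"
    and "\<And>ys. F 0 ys = f ys" "\<And>k ys. F (Suc k) ys = g (k # F k ys # ys)"
  shows "total_recursive (Suc n) (\<lambda>xs. F (hd xs) (tl xs))"
proof (rule partial_recursive_cong[OF partial_recursive_primrec[OF assms(1-3)]])
  fix xs :: "nat list"
  have "rec_nat (Some (f (tl xs)))
      (\<lambda>k r. Option.bind r (\<lambda>v. Some (g (k # v # tl xs)))) m = Some (F m (tl xs))" for m
    by (induction m) (auto simp: assms)
  then show "rec_nat (Some (f (tl xs)))
      (\<lambda>k r. Option.bind r (\<lambda>v. Some (g (k # v # tl xs)))) (hd xs) = Some (F (hd xs) (tl xs))"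
    by blast
qed

text \<open>Combines recursion with one parameter and the substitution of \<open>p\<close> and
  \<open>q\<close>, so that an arithmetic function needs only its two recursion equations.\<close>

lemma total_recursive_primrec2:
  assumes "total_recursive 1 f" "total_recursive 3 g"
    and "\<And>y. F 0 y = f [y]" "\<And>k y. F (Suc k) y = g [k, F k y, y]"
    and "total_recursive n p" "total_recursive n q"
  shows "total_recursive n (\<lambda>xs. F (p xs) (q xs))"
proof -
  \<comment> \<open>The general rule recurses over parameter lists. \<open>G\<close> does so and
    agrees with \<open>F\<close> on singletons.\<close>
  define G where "G k ys = rec_nat (f ys) (\<lambda>k v. g (k # v # ys)) k" for k ys
  have G: "G k [y] = F k y" for k y
    unfolding G_def by (induction k) (simp_all add: assms(3,4))
  have "total_recursive (Suc 1) (\<lambda>xs. G (hd xs) (tl xs))"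
    using assms(1,2) by (intro total_recursive_primrec[where f = f and g = g])
      (simp_all add: G_def numeral_3_eq_3)
  then have "total_recursive 2 (\<lambda>xs. G (hd xs) (tl xs))"
    by (simp add: numeral_2_eq_2)
  from partial_recursive_comp2[OF this assms(5,6)] show ?thesis by (simp add: G)
qed

section \<open>Arithmetic, case distinction and pairing\<close>

lemma total_recursive_add:
  assumes "total_recursive n p" "total_recursive n q"
  shows "total_recursive n (\<lambda>xs. p xs + q xs)"
  by (rule total_recursive_primrec2[where f = "\<lambda>xs. xs ! 0" and g = "\<lambda>xs. Suc (xs ! 1)"])
    (simp_all add: assms total_recursive_proj total_recursive_Suc)

lemma total_recursive_pred:
  assumes "total_recursive n p"
  shows "total_recursive n (\<lambda>xs. p xs - 1)"
  by (rule total_recursive_primrec2[where F = "\<lambda>k y. k - 1" and q = p and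
        f = "\<lambda>xs. 0" and g = "\<lambda>xs. xs ! 0"])
    (simp_all add: assms total_recursive_proj total_recursive_const)

lemma total_recursive_diff:
  assumes "total_recursive n p" "total_recursive n q"
  shows "total_recursive n (\<lambda>xs. p xs - q xs)"
  by (rule total_recursive_primrec2[where F = "\<lambda>k y. y - k" and
        f = "\<lambda>xs. xs ! 0" and g = "\<lambda>xs. xs ! 1 - 1"])
    (simp_all add: assms total_recursive_proj total_recursive_pred[simplified])

text \<open>Recursion on the condition: the base value is the first branch, and every successor step
  returns the second.\<close>

lemma total_recursive_if_zero:
  assumes "total_recursive n c" "total_recursive n p" "total_recursive n q"
  shows "total_recursive n (\<lambda>xs. if c xs = 0 then p xs else q xs)"
proof -
  define F :: "nat \<Rightarrow> nat list \<Rightarrow> nat" where "F k ys = (if k = 0 then ys ! 0 else ys ! 1)" for k ys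
  have "total_recursive (Suc 2) (\<lambda>xs. F (hd xs) (tl xs))"
    \<comment> \<open>The step function sees the counter, the previous value and the two branches,
      so position 3 is the second branch.\<close>
    by (intro total_recursive_primrec[where f = "\<lambda>xs. xs ! 0" and g = "\<lambda>xs. xs ! 3"])
      (simp_all add: F_def total_recursive_proj numeral_3_eq_3)
  then have "total_recursive 3 (\<lambda>xs. F (hd xs) (tl xs))" by simp
  from partial_recursive_comp3[OF this assms] show ?thesis by (simp add: F_def cong: if_cong)
qed

lemma total_recursive_if_eq:
  assumes "total_recursive n c" "total_recursive n d" "total_recursive n p" "total_recursive n q"
  shows "total_recursive n (\<lambda>xs. if c xs = d xs then p xs else q xs)"
proof -
  \<comment> \<open>Subtraction is truncated, so the sum of both differences vanishes exactly if the
    two numbers are equal.\<close>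
  have "total_recursive n (\<lambda>xs. if (c xs - d xs) + (d xs - c xs) = 0 then p xs else q xs)"
    by (intro total_recursive_if_zero total_recursive_add total_recursive_diff assms)
  then show ?thesis by (rule partial_recursive_cong) auto
qed

lemma total_recursive_triangle:
  assumes "total_recursive n p"
  shows "total_recursive n (\<lambda>xs. triangle (p xs))"
  by (rule total_recursive_primrec2[where F = "\<lambda>k y. triangle k" and q = p and
        f = "\<lambda>xs. 0" and g = "\<lambda>xs. xs ! 1 + Suc (xs ! 0)"])
    (simp_all add: assms total_recursive_proj total_recursive_const total_recursive_add
      total_recursive_Suc)

lemma total_recursive_prod_encode:
  assumes "total_recursive n p" "total_recursive n q"
  shows "total_recursive n (\<lambda>xs. prod_encode (p xs, q xs))"
  unfolding prod_encode_def prod.case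
  by (intro total_recursive_add total_recursive_triangle assms)

section \<open>Computable decoding of pairs\<close>

abbreviation pfst :: "nat \<Rightarrow> nat" where "pfst x \<equiv> fst (prod_decode x)"
abbreviation psnd :: "nat \<Rightarrow> nat" where "psnd x \<equiv> snd (prod_decode x)"

text \<open>The largest \<open>w\<close> with \<open>triangle w \<le> x\<close>, phrased as the
  least zero of a truncated difference so that minimisation computes it.\<close>

definition triangle_root :: "nat \<Rightarrow> nat" where
  "triangle_root x = (LEAST w. Suc x - triangle (Suc w) = 0)"

lemma mono_triangle: "m \<le> n \<Longrightarrow> triangle m \<le> triangle n"
  by (induction n rule: nat_induct) (auto simp: le_Suc_eq)

text \<open>The code of \<open>(a, b)\<close> is \<open>triangle (a + b) + a\<close>, which lies
  below the next triangular number because \<open>a \<le> a + b\<close>.\<close>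

lemma triangle_root_prod_encode: "triangle_root (prod_encode (a, b)) = a + b"
  unfolding triangle_root_def
proof (rule Least_equality)
  show "Suc (prod_encode (a, b)) - triangle (Suc (a + b)) = 0"
    by (simp add: prod_encode_def)
next
  fix w assume "Suc (prod_encode (a, b)) - triangle (Suc w) = 0"
  then have "triangle (a + b) < triangle (Suc w)"
    by (simp add: prod_encode_def del: triangle_Suc)
  then have "a + b < Suc w" using mono_triangle[of "Suc w" "a + b"] by linarith
  then show "a + b \<le> w" by simp
qed

lemma prod_decode_triangle_root:
  "pfst x = x - triangle (triangle_root x)" "psnd x = triangle_root x - pfst x"
proof -
  obtain a b where "x = prod_encode (a, b)" by (metis prod_decode_inverse surj_pair)
  then show "pfst x = x - triangle (triangle_root x)" "psnd x = triangle_root x - pfst x"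
    by (simp_all add: triangle_root_prod_encode) (simp add: prod_encode_def)
qed

lemma total_recursive_triangle_root:
  assumes "total_recursive n p"
  shows "total_recursive n (\<lambda>xs. triangle_root (p xs))"
proof -
  have "total_recursive 1
    (\<lambda>xs. LEAST w. (\<lambda>xs. Suc (xs ! 1) - triangle (Suc (xs ! 0))) (w # xs) = 0)"
  proof (rule partial_recursive_least)
    show "total_recursive (Suc 1) (\<lambda>xs. Suc (xs ! 1) - triangle (Suc (xs ! 0)))"
      by (intro total_recursive_diff total_recursive_triangle total_recursive_Suc
          total_recursive_proj) auto
    show "\<exists>w. Suc ((w # xs) ! 1) - triangle (Suc ((w # xs) ! 0)) = 0" for xs
      \<comment> \<open>A triangular number is at least as large as its index.\<close>
      by (rule exI[of _ "xs ! 0"]) simp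
  qed
  from partial_recursive_comp1[OF this assms] show ?thesis
    by (simp add: triangle_root_def)
qed

lemma total_recursive_pfst:
  assumes "total_recursive n p" shows "total_recursive n (\<lambda>xs. pfst (p xs))"
  unfolding prod_decode_triangle_root(1)
  by (intro total_recursive_diff total_recursive_triangle total_recursive_triangle_root assms)

lemma total_recursive_psnd:
  assumes "total_recursive n p" shows "total_recursive n (\<lambda>xs. psnd (p xs))"
  unfolding prod_decode_triangle_root(2)
  by (intro total_recursive_diff total_recursive_pfst total_recursive_triangle_root assms)

lemmas recursive_intros =
  total_recursive_const total_recursive_Suc total_recursive_if_eq
  total_recursive_prod_encode total_recursive_pfst total_recursive_psnd total_recursive_diff
  total_recursive_proj

section \<open>The diagonal sets and their uniform computability\<close>

definition item :: "nat \<Rightarrow> nat \<Rightarrow> nat \<Rightarrow> nat" where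
  "item k i e = prod_encode (k, prod_encode (i, e))"

text \<open>The code of the input \<open>Step e (Some y)\<close>, written on numbers alone so that
  it composes with recursive functions.\<close>

definition step_code :: "nat \<Rightarrow> nat \<Rightarrow> nat" where
  "step_code e y = Suc (prod_encode (e, Suc y))"

lemma item_eq_iff [simp]: "item k i e = item k' i' e' \<longleftrightarrow> k = k' \<and> i = i' \<and> e = e'"
  by (simp add: item_def)

lemma code_input_simps:
  "code_input Start = 0" "code_input (Step e (Some y)) = step_code e y"
  by (simp_all add: code_input_def code_datum_def step_code_def)

text \<open>\<open>trace f i\<close> follows the learner with code \<open>f\<close> while it is fed \<open>item k i e\<close> at time
  \<open>k\<close> in state \<open>e\<close>: it is \<open>Suc e\<close> as long as the learner has changed its mind at every
  step, and \<open>0\<close> from then on.\<close>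

fun trace :: "(nat \<Rightarrow> nat) \<Rightarrow> nat \<Rightarrow> nat \<Rightarrow> nat" where
  "trace f i 0 = Suc (f 0)"
| "trace f i (Suc k) =
    (let e = trace f i k - 1; v = f (step_code e (item k i e))
     in if trace f i k = 0 then 0 else if v = e then 0 else Suc v)"

text \<open>For \<open>f\<close> the total function with index \<open>i\<close>, this is the set
  \<open>B\<^sub>i\<close> of the overview, and \<open>diag_lower\<close> is
  \<open>A\<^sub>i\<close>.\<close>

definition diag_upper :: "(nat \<Rightarrow> nat) \<Rightarrow> nat \<Rightarrow> nat set" where
  "diag_upper f i = {item k i e |k e. trace f i k = Suc e}"

definition diag_lower :: "(nat \<Rightarrow> nat) \<Rightarrow> nat \<Rightarrow> nat set" where
  "diag_lower f i = {item k i e |k e. trace f i k = Suc e \<and> trace f i (Suc k) \<noteq> 0}"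

lemma diag_lower_subset: "diag_lower f i \<subseteq> diag_upper f i"
  by (auto simp: diag_lower_def diag_upper_def)

text \<open>An item records its own time, so the trace at that time and the next one decides
  membership, even if the trace never reaches \<open>0\<close>.\<close>

lemma item_diag_iff:
  "item k j e \<in> diag_upper f i \<longleftrightarrow> j = i \<and> trace f i k = Suc e"
  "item k j e \<in> diag_lower f i \<longleftrightarrow> j = i \<and> trace f i k = Suc e \<and> trace f i (Suc k) \<noteq> 0"
  by (auto simp: diag_lower_def diag_upper_def simp del: trace.simps)

lemma diag_upper_nonempty: "diag_upper f i \<noteq> {}"
  using item_diag_iff(1)[of 0 i "f 0" f i] by auto

lemma trace_stays_zero: "trace f i k = 0 \<Longrightarrow> k \<le> m \<Longrightarrow> trace f i m = 0"
  by (induction m rule: nat_induct) (auto simp: le_Suc_eq)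

text \<open>A version of \<open>trace\<close> for programs that may diverge. It is uniform in the
  index, so that acceptability can provide indices of the diagonal sets computably. The program is
  queried even when \<open>u = 0\<close>, on the junk state \<open>0\<close>; a total program still
  answers.\<close>

definition ptrace :: "(nat \<Rightarrow> nat \<Rightarrow> nat option) \<Rightarrow> nat \<Rightarrow> nat \<Rightarrow> nat option" where
  "ptrace \<phi> i k = rec_nat (Option.bind (\<phi> i 0) (\<lambda>v. Some (Suc v)))
     (\<lambda>k r. Option.bind r (\<lambda>u. Option.bind (\<phi> i (step_code (u - 1) (item k i (u - 1))))
       (\<lambda>v. Some (if u = 0 then 0 else if v = u - 1 then 0 else Suc v)))) k"

definition pdiag_upper :: "(nat \<Rightarrow> nat \<Rightarrow> nat option) \<Rightarrow> nat \<Rightarrow> nat \<Rightarrow> nat option" where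
  "pdiag_upper \<phi> i x = Option.bind (ptrace \<phi> i (pfst x))
     (\<lambda>u. Some (if pfst (psnd x) = i then if u = Suc (psnd (psnd x)) then 1 else 0 else 0))"

definition pdiag_lower :: "(nat \<Rightarrow> nat \<Rightarrow> nat option) \<Rightarrow> nat \<Rightarrow> nat \<Rightarrow> nat option" where
  "pdiag_lower \<phi> i x = Option.bind (ptrace \<phi> i (Suc (pfst x)))
     (\<lambda>w. Option.bind (pdiag_upper \<phi> i x) (\<lambda>v. Some (if w = 0 then 0 else v)))"

lemma ptrace_total:
  assumes "\<phi> i = (\<lambda>x. Some (f x))"
  shows "ptrace \<phi> i k = Some (trace f i k)"
  unfolding ptrace_def by (induction k) (simp_all add: assms Let_def)

lemma pdiag_total:
  assumes "\<phi> i = (\<lambda>x. Some (f x))"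
  shows "pdiag_upper \<phi> i x = Some (if x \<in> diag_upper f i then 1 else 0)"
    and "pdiag_lower \<phi> i x = Some (if x \<in> diag_lower f i then 1 else 0)"
proof -
  \<comment> \<open>Pairing is bijective, so every number is an item.\<close>
  obtain k j e where x: "x = item k j e"
    unfolding item_def by (metis prod_decode_inverse surj_pair)
  then have [simp]: "pfst x = k" "pfst (psnd x) = j" "psnd (psnd x) = e"
    by (simp_all add: item_def)
  note [simp] = ptrace_total[of \<phi> i f, OF assms] and [simp del] = trace.simps
  show upper: "pdiag_upper \<phi> i x = Some (if x \<in> diag_upper f i then 1 else 0)"
    unfolding pdiag_upper_def by simp (simp add: x item_diag_iff)
  have "x \<in> diag_lower f i \<longleftrightarrow> trace f i (Suc k) \<noteq> 0 \<and> x \<in> diag_upper f i"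
    by (auto simp: x item_diag_iff)
  then show "pdiag_lower \<phi> i x = Some (if x \<in> diag_lower f i then 1 else 0)"
    unfolding pdiag_lower_def upper by simp
qed

lemma partial_computable2_comp:
  assumes "partial_computable2 \<psi>" "total_recursive n p" "total_recursive n q"
  shows "partial_recursive n (\<lambda>xs. \<psi> (p xs) (q xs))"
  using partial_recursive_comp2[OF assms(1)[unfolded partial_computable2_def] assms(2,3)] by simp

lemma total_computable_comp:
  assumes "total_computable f" "total_recursive n p"
  shows "total_recursive n (\<lambda>xs. f (p xs))"
  using partial_recursive_comp1[OF assms(1)[unfolded total_computable_def partial_computable_def]
      assms(2)] by simp

text \<open>\<open>PrimRec\<close> expects the recursion variable first, whereas
  \<open>ptrace\<close> takes the index first; the recursion is built in the former order and the
  arguments are swapped at the end.\<close>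

lemma partial_computable2_ptrace:
  assumes "partial_computable2 \<phi>"
  shows "partial_computable2 (ptrace \<phi>)"
proof -
  define base where "base = (\<lambda>xs. Option.bind (\<phi> (xs ! 0) 0) (\<lambda>v. Some (Suc v)))"
  \<comment> \<open>Position 0 holds the time, 1 the previous trace value and 2 the index of the
    program.\<close>
  define step where "step = (\<lambda>xs. Option.bind
      (\<phi> (xs ! 2) (step_code (xs ! 1 - 1) (item (xs ! 0) (xs ! 2) (xs ! 1 - 1))))
       (\<lambda>v. Some (if xs ! 1 = 0 then 0 else if v = xs ! 1 - 1 then 0 else Suc v)))"
  have base: "partial_recursive 1 base"
    unfolding base_def
    by (rule partial_recursive_bind[where g = "\<lambda>ys. Some (Suc (ys ! 0))"];
        (intro partial_computable2_comp[OF assms] recursive_intros)?) auto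
  have step: "partial_recursive (Suc (Suc 1)) step"
    unfolding step_def step_code_def item_def
    \<comment> \<open>The answer to the query is now at position 0, which moves the previous trace
      value to position 2.\<close>
    by (rule partial_recursive_bind[where g = "\<lambda>ys. Some (if ys ! 2 = 0 then 0
          else if ys ! 0 = ys ! 2 - 1 then 0 else Suc (ys ! 0))"];
        (intro partial_computable2_comp[OF assms] recursive_intros)?) auto
  have rec: "partial_recursive 2
      (\<lambda>xs. rec_nat (base (tl xs)) (\<lambda>k r. Option.bind r (\<lambda>v. step (k # v # tl xs))) (hd xs))"
    using partial_recursive_primrec[OF base step] by (simp add: numeral_2_eq_2)
  have "partial_recursive 2 (\<lambda>xs. rec_nat (base [xs ! 0])
      (\<lambda>k r. Option.bind r (\<lambda>v. step [k, v, xs ! 0])) (xs ! 1))"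
    using partial_recursive_comp2[OF rec total_recursive_proj[of 1] total_recursive_proj[of 0]]
    by simp
  then show ?thesis
    unfolding partial_computable2_def
    by (rule partial_recursive_cong) (simp add: ptrace_def base_def step_def del: One_nat_def cong: if_cong)
qed

lemma partial_computable2_pdiag_upper:
  assumes "partial_computable2 \<phi>"
  shows "partial_computable2 (pdiag_upper \<phi>)"
  unfolding partial_computable2_def pdiag_upper_def
  by (rule partial_recursive_bind[where g = "\<lambda>ys. Some (if pfst (psnd (ys ! 2)) = ys ! 1
        then if ys ! 0 = Suc (psnd (psnd (ys ! 2))) then 1 else 0 else 0)"];
      (intro partial_computable2_comp[OF partial_computable2_ptrace[OF assms]] recursive_intros)?) auto

lemma partial_computable2_pdiag_lower:
  assumes "partial_computable2 \<phi>"
  shows "partial_computable2 (pdiag_lower \<phi>)"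
proof -
  \<comment> \<open>The inner bind, with the trace value at the successor time already bound at
    position 0.\<close>
  have "partial_recursive (Suc 2) (\<lambda>xs. Option.bind (pdiag_upper \<phi> (xs ! 1) (xs ! 2))
     (\<lambda>v. Some (if xs ! 0 = 0 then 0 else v)))"
    by (rule partial_recursive_bind[where g = "\<lambda>ys. Some (if ys ! 1 = 0 then 0 else ys ! 0)"];
        (intro partial_computable2_comp[OF partial_computable2_pdiag_upper[OF assms]]
          recursive_intros)?) auto
  moreover have "partial_recursive 2 (\<lambda>xs. ptrace \<phi> (xs ! 0) (Suc (pfst (xs ! 1))))"
    by (intro partial_computable2_comp[OF partial_computable2_ptrace[OF assms]] recursive_intros) auto
  ultimately show ?thesis
    unfolding partial_computable2_def pdiag_lower_def
    by (intro partial_recursive_bind) auto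
qed


section \<open>A partial learner for all diagonal sets\<close>

text \<open>The index \<open>z\<close> of a total function is queried in place of \<open>i\<close> when there is no datum:
  evaluation is strict, so the learner would otherwise diverge there on junk queries.\<close>

definition plearner ::
  "(nat \<Rightarrow> nat \<Rightarrow> nat option) \<Rightarrow> nat \<Rightarrow> (nat \<Rightarrow> nat) \<Rightarrow> (nat \<Rightarrow> nat) \<Rightarrow> nat \<Rightarrow> nat option" where
  "plearner \<phi> z a b n =
    (let e = pfst (n - 1); d = psnd (n - 1); y = d - 1; i = pfst (psnd y); c = psnd (psnd y)
     in Option.bind (\<phi> (if d = 0 then z else i) (step_code c y))
       (\<lambda>v. Some (if n = 0 then z else if d = 0 then e else if e = b i then b i
         else if v = c then b i else a i)))"

lemma partial_computable_plearner:
  assumes \<phi>: "partial_computable2 \<phi>" and a: "total_computable a" and b: "total_computable b"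
  shows "partial_computable (plearner \<phi> z a b)"
  unfolding partial_computable_def plearner_def Let_def step_code_def
  \<comment> \<open>Here \<open>ys ! 0\<close> is the answer to the query and \<open>ys ! 1\<close>
    the coded input.\<close>
  by (rule partial_recursive_bind[where g = "\<lambda>ys. Some
        (if ys ! 1 = 0 then z else if psnd (ys ! 1 - 1) = 0 then pfst (ys ! 1 - 1)
         else if pfst (ys ! 1 - 1) = b (pfst (psnd (psnd (ys ! 1 - 1) - 1)))
           then b (pfst (psnd (psnd (ys ! 1 - 1) - 1)))
         else if ys ! 0 = psnd (psnd (psnd (ys ! 1 - 1) - 1))
           then b (pfst (psnd (psnd (ys ! 1 - 1) - 1)))
         else a (pfst (psnd (psnd (ys ! 1 - 1) - 1))))"];
      (intro partial_computable2_comp[OF \<phi>] recursive_intros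
        total_computable_comp[OF a] total_computable_comp[OF b])?) auto

lemma plearner_simps:
  assumes "\<And>x. \<phi> z x = Some 0"
  shows "plearner \<phi> z a b (code_input Start) = Some z"
    and "plearner \<phi> z a b (code_input (Step e None)) = Some e"
proof -
  \<comment> \<open>For \<open>Start\<close> the truncated \<open>n - 1\<close> is \<open>0\<close>,
    which decodes to datum code \<open>0\<close>; hence the query goes to the total program
    \<open>z\<close>.\<close>
  have "prod_decode 0 = (0, 0)"
    using prod_encode_inverse[of "(0, 0)"] by (simp add: prod_encode_def)
  then show "plearner \<phi> z a b (code_input Start) = Some z"
    by (simp add: plearner_def code_input_def assms)
  show "plearner \<phi> z a b (code_input (Step e None)) = Some e"
    by (simp add: plearner_def code_input_def code_datum_def assms)
qed

text \<open>The item carries the state in which it was fed, so rerunning a single step of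
  \<open>f\<close> shows whether it caused a mind change. Totality of \<open>f\<close> makes this
  run converge.\<close>

lemma plearner_item:
  assumes f: "\<phi> i = (\<lambda>x. Some (f x))" and y: "y \<in> diag_upper f i"
  shows "plearner \<phi> z a b (code_input (Step e (Some y))) =
    Some (if e = b i then b i else if y \<in> diag_lower f i then a i else b i)"
proof -
  obtain k c where k: "y = item k i c" "trace f i k = Suc c"
    using y unfolding diag_upper_def by blast
  have "y \<in> diag_lower f i \<longleftrightarrow> f (step_code c y) \<noteq> c"
    using k by (simp add: item_diag_iff Let_def)
  moreover have "pfst (psnd y) = i" "psnd (psnd y) = c"
    using k(1) by (simp_all add: item_def)
  ultimately show ?thesis
    by (simp add: plearner_def code_input_simps(2) f) (simp add: step_code_def f)
qed

text \<open>On data from \<open>U\<close> the conjecture depends only on the set of data seen: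
  \<open>z\<close> for none, \<open>b\<close> once an element outside \<open>A\<close> has occurred,
  and \<open>a\<close> otherwise. Such a conjecture settles on every text for \<open>A\<close> or
  \<open>U\<close>.\<close>

lemma switching_learner_learns:
  assumes start: "h Start = Some z" and pause: "\<And>e. h (Step e None) = Some e"
    and datum: "\<And>e y. y \<in> U \<Longrightarrow>
      h (Step e (Some y)) = Some (if e = b then b else if y \<in> A then a else b)"
    and z: "C_index \<phi> z" "C_set \<phi> z = {}" and a: "C_index \<phi> a" "C_set \<phi> a = A"
    and b: "C_index \<phi> b" "C_set \<phi> b = U"
    and sub: "A \<subseteq> U" "U \<noteq> {}" and L: "L = A \<or> L = U"
  shows "learns It (CIndEx_C \<phi>) h L"
  unfolding learns_def
proof (intro allI impI)
  fix T assume "text_for T L"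
  then have T: "content T = L" by (simp add: text_for_def)
  define seen where "seen n = {y. \<exists>m<n. T m = Some y}" for n
  define hyp where "hyp S = (if S = {} then z else if S \<inter> (U - A) \<noteq> {} then b else a)" for S
  have seen_Suc: "seen (Suc n) = seen n \<union> set_option (T n)" for n
    by (cases "T n") (auto simp: seen_def less_Suc_eq)
  have seen_sub: "seen n \<subseteq> L" for n
    using T by (auto simp: seen_def content_def) (metis rangeI)
  \<comment> \<open>\<open>U\<close> is nonempty, so the initial conjecture is never mistaken for
    the final \<open>b\<close>.\<close>
  have "z \<noteq> b" using z b sub by auto
  have It: "It h T n = Some (hyp (seen n))" for n
  proof (induction n)
    case 0
    then show ?case by (simp add: start hyp_def seen_def)
  next
    case (Suc n)
    show ?case
    proof (cases "T n")
      case None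
      then show ?thesis using Suc by (simp add: pause seen_Suc)
    next
      case (Some y)
      have "y \<in> L" using seen_sub[of "Suc n"] Some by (simp add: seen_Suc)
      then have y: "y \<in> U" using L sub by auto
      have "seen n \<subseteq> U" using seen_sub L sub by blast
      show ?thesis
      proof (cases "hyp (seen n) = b")
        case True
        then have "seen n \<noteq> {}" using \<open>z \<noteq> b\<close> by (auto simp: hyp_def)
        \<comment> \<open>The indices \<open>a\<close> and \<open>b\<close> may coincide, namely
          when \<open>A = U\<close>; the conjecture stays \<open>b\<close> in that case too.\<close>
        then have "seen n \<inter> (U - A) \<noteq> {} \<or> a = b"
          using True by (auto simp: hyp_def split: if_splits)
        then have "hyp (insert y (seen n)) = b" by (auto simp: hyp_def)
        then show ?thesis using Suc Some True y by (simp add: datum seen_Suc)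
      next
        case False
        then have "seen n \<inter> (U - A) = {}" by (auto simp: hyp_def split: if_splits)
        then have "hyp (insert y (seen n)) = (if y \<in> A then a else b)"
          using y by (auto simp: hyp_def)
        then show ?thesis using Suc Some False y by (simp add: datum seen_Suc)
      qed
    qed
  qed
  have "\<exists>n\<^sub>0. \<forall>n\<ge>n\<^sub>0. hyp (seen n) = hyp L"
  proof -
    have eventually_seen: "\<exists>n\<^sub>0. \<forall>n\<ge>n\<^sub>0. y \<in> seen n" if "y \<in> L" for y
    proof -
      obtain m where "T m = Some y" using \<open>y \<in> L\<close> T unfolding content_def by force
      then have "\<forall>n\<ge>Suc m. y \<in> seen n" unfolding seen_def by (blast dest: Suc_le_lessD)
      then show ?thesis by blast
    qed
    \<comment> \<open>The limits are \<open>z\<close> when nothing ever appears, \<open>b\<close>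
      from an element outside \<open>A\<close> onwards, and \<open>a\<close> from the first datum
      onwards.\<close>
    consider "L = {}" | y where "y \<in> L" "y \<in> U - A" | y where "y \<in> L" "L \<inter> (U - A) = {}"
      by blast
    then show ?thesis
    proof cases
      case 1
      then show ?thesis using seen_sub by auto
    next
      case 2
      then have "hyp S = hyp L" if "y \<in> S" for S using that by (auto simp: hyp_def)
      then show ?thesis using eventually_seen[OF 2(1)] by metis
    next
      case 3
      then have "hyp S = hyp L" if "y \<in> S" "S \<subseteq> L" for S using that by (auto simp: hyp_def)
      then show ?thesis using eventually_seen[OF 3(1)] seen_sub by metis
    qed
  qed
  then obtain n\<^sub>0 where n\<^sub>0: "\<And>n. n \<ge> n\<^sub>0 \<Longrightarrow> hyp (seen n) = hyp L" by blast
  have "C_index \<phi> (hyp S)" for S using z a b by (simp add: hyp_def)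
  moreover have "C_set \<phi> (hyp L) = L"
    using z a b sub L by (auto simp: hyp_def)
  ultimately show "CIndEx_C \<phi> (It h T) T"
    unfolding CIndEx_C_def CInd_def Ex_C_def using It n\<^sub>0 T by (metis order_refl)
qed

section \<open>Failure of every total learner\<close>

lemma Ex_C_limit:
  assumes "Ex_C \<phi> p T"
  obtains n\<^sub>0 e where "\<forall>n\<ge>n\<^sub>0. p n = Some e" "C_set \<phi> e = content T"
  using assms unfolding Ex_C_def by metis

text \<open>The learner is fed items built from its own states. Either all of them change its mind,
  or two texts with different contents lead it to the same limit.\<close>

lemma total_learner_fails:
  assumes h: "\<And>x. h x = Some (f (code_input x))"
    and lower: "learns It (CIndEx_C \<phi>) h (diag_lower f i)"
    and upper: "learns It (CIndEx_C \<phi>) h (diag_upper f i)"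
  shows False
proof -
  define e where "e k = trace f i k - 1" for k
  \<comment> \<open>The first \<open>n\<close> items followed by pauses only.\<close>
  define T where "T n = (\<lambda>k. if k < n then Some (item k i (e k)) else None)" for n
  have step: "h (Step (e k) (Some (item k i (e k)))) =
      Some (f (step_code (e k) (item k i (e k))))" for k
    by (simp add: h code_input_simps)
  have trace_0: "It h X 0 = Some (e 0)" for X
    by (simp add: h e_def code_input_simps)
  have next_state: "h (Step (e k) (Some (item k i (e k)))) = Some (e (Suc k))"
    if "trace f i (Suc k) \<noteq> 0" for k
    using that by (simp add: step) (auto simp: e_def Let_def split: if_splits)
  have It_e: "It h X n = Some (e n)"
    if "\<And>k. k < n \<Longrightarrow> X k = Some (item k i (e k))" "\<And>k. k \<le> n \<Longrightarrow> trace f i k \<noteq> 0" for X n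
    using that
  proof (induction n)
    case 0
    show ?case by (rule trace_0)
  next
    case (Suc n)
    then have "It h X n = Some (e n)" "X n = Some (item n i (e n))" by simp_all
    then show ?case using next_state[of n] Suc.prems(2)[of "Suc n"] by (simp del: trace.simps)
  qed
  show False
  proof (cases "\<exists>k. trace f i k = 0")
    \<comment> \<open>All items fed belong to the lower set, but consecutive states differ, which
      rules out a limit.\<close>
    case False
    define X where "X k = Some (item k i (e k))" for k
    have "content X = diag_lower f i"
    proof -
      have "trace f i k = Suc (e k)" for k using False by (simp add: e_def)
      then show ?thesis using False
        by (auto simp: X_def content_def diag_lower_def simp del: trace.simps)
    qed
    then have "Ex_C \<phi> (It h X) X"
      using lower by (auto simp: learns_def text_for_def CIndEx_C_def)
    moreover have "It h X n = Some (e n)" for n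
      using False by (intro It_e) (auto simp: X_def)
    ultimately obtain n c where "Some (e m) = Some c" if "m \<ge> n" for m
      by (metis Ex_C_limit)
    from this[of n] this[of "Suc n"] have "e (Suc n) = e n" by simp
    moreover have "trace f i n \<noteq> 0" "trace f i (Suc n) \<noteq> 0" using False by (auto simp del: trace.simps)
    ultimately show False by (auto simp: e_def Let_def split: if_splits)
  next
    case True
    define m where "m = (LEAST k. trace f i k = 0)"
    have m: "trace f i m = 0" using True unfolding m_def by (rule LeastI_ex)
    have before: "trace f i k \<noteq> 0" if "k < m" for k
      using that not_less_Least unfolding m_def by blast
    \<comment> \<open>The trace starts with a successor, so \<open>m\<close> is positive;
      \<open>k\<close> is the time at which the learner first keeps its state.\<close>
    obtain k where k: "m = Suc k" using m by (cases m) auto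
    have zero_iff: "trace f i j = 0 \<longleftrightarrow> m \<le> j" for j
      using before trace_stays_zero[OF m] by (meson not_le)
    have content: "content (T n) = {item j i (e j) |j. j < n}" for n
      unfolding content_def T_def by (force split: if_splits)
    have suc: "trace f i j = Suc c \<longleftrightarrow> j < m \<and> c = e j" for j c
      using zero_iff[of j] by (cases "trace f i j") (auto simp: e_def)
    have "content (T (Suc k)) = diag_upper f i"
      unfolding content diag_upper_def suc k by blast
    then have up: "Ex_C \<phi> (It h (T (Suc k))) (T (Suc k))"
      using upper by (simp add: learns_def text_for_def CIndEx_C_def)
    have "content (T k) = diag_lower f i"
      unfolding content diag_lower_def suc zero_iff k by (auto simp: not_le)
    then have low: "Ex_C \<phi> (It h (T k)) (T k)"
      using lower by (simp add: learns_def text_for_def CIndEx_C_def)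
    have "It h (T (Suc k)) k = Some (e k)" and low_k: "It h (T k) k = Some (e k)"
      by (auto intro!: It_e before simp: T_def k)
    moreover have "f (step_code (e k) (item k i (e k))) = e k"
      using m before[of k] by (auto simp: k e_def Let_def split: if_splits)
    ultimately have "It h (T (Suc k)) (Suc k) = Some (e k)"
      by (simp add: step T_def)
    \<comment> \<open>Ignoring item \<open>k\<close> leaves the learner in the state it has on
      \<open>T k\<close> one step earlier. Both texts continue with pauses, so the runs agree up to
      this delay.\<close>
    then have shift: "It h (T (Suc k)) (Suc k + n) = It h (T k) (k + n)" for n
      using low_k by (induction n) (simp_all add: T_def)
    from low obtain n\<^sub>1 c\<^sub>1 where 1: "\<forall>n\<ge>n\<^sub>1. It h (T k) n = Some c\<^sub>1"
      "C_set \<phi> c\<^sub>1 = content (T k)"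
      by (rule Ex_C_limit)
    from up obtain n\<^sub>2 c\<^sub>2 where 2: "\<forall>n\<ge>n\<^sub>2. It h (T (Suc k)) n = Some c\<^sub>2"
      "C_set \<phi> c\<^sub>2 = content (T (Suc k))"
      by (rule Ex_C_limit)
    \<comment> \<open>The offset \<open>n\<^sub>1 + n\<^sub>2\<close> is late enough for both limits
      to have been reached.\<close>
    have "c\<^sub>1 = c\<^sub>2"
      using 1(1)[rule_format, of "k + (n\<^sub>1 + n\<^sub>2)"] 2(1)[rule_format, of "Suc k + (n\<^sub>1 + n\<^sub>2)"] shift[of "n\<^sub>1 + n\<^sub>2"] by simp
    then have "content (T k) = content (T (Suc k))" using 1(2) 2(2) by simp
    \<comment> \<open>Items of different times are different, so item \<open>k\<close> does not
      occur in \<open>T k\<close>.\<close>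
    moreover have "item k i (e k) \<in> content (T (Suc k)) - content (T k)"
      unfolding content by auto
    ultimately show False by blast
  qed
qed

section \<open>Separation of total from partial iterative learning\<close>

lemma C_index_characteristic:
  assumes "\<And>x. \<phi> e x = Some (if x \<in> A then 1 else 0)"
  shows "C_index \<phi> e" "C_set \<phi> e = A"
  using assms by (auto simp: C_index_def C_set_def split: if_splits)

theorem theorem6:
  fixes \<phi> :: "nat \<Rightarrow> nat \<Rightarrow> nat option"
  assumes "acceptable_numbering \<phi>"
  shows "Txt_REC total_learners It (CIndEx_C \<phi>) \<subset> Txt_REC partial_learners It (CIndEx_C \<phi>)"
proof -
  have range: "range \<phi> = {\<psi>. partial_computable \<psi>}" and \<phi>: "partial_computable2 \<phi>" and
    smn: "\<And>\<psi>. partial_computable2 \<psi> \<Longrightarrow> \<exists>s. total_computable s \<and> (\<forall>e. \<phi> (s e) = \<psi> e)"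
    using assms by (simp_all add: acceptable_numbering_def)
  obtain a where a: "total_computable a" "\<And>i. \<phi> (a i) = pdiag_lower \<phi> i"
    using smn[OF partial_computable2_pdiag_lower[OF \<phi>]] by blast
  obtain b where b: "total_computable b" "\<And>i. \<phi> (b i) = pdiag_upper \<phi> i"
    using smn[OF partial_computable2_pdiag_upper[OF \<phi>]] by blast
  \<comment> \<open>An index of the constant \<open>0\<close> serves both as the conjecture for the
    empty set and as the total program for dummy queries.\<close>
  have "partial_computable (\<lambda>x. Some 0)"
    unfolding partial_computable_def by (rule total_recursive_const)
  then have "(\<lambda>x. Some 0) \<in> range \<phi>" unfolding range by simp
  then obtain z' where "(\<lambda>x. Some 0) = \<phi> z'" by (rule rangeE)
  then have "\<phi> z' x = Some 0" for x by metis
  then obtain z where z: "\<And>x. \<phi> z x = Some 0" by metis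
  define F where "F i x = the (\<phi> i x)" for i x
  \<comment> \<open>The equation holds exactly for the indices of total functions, since
    \<open>the\<close> loses only divergence.\<close>
  define I where "I = {i. \<phi> i = (\<lambda>x. Some (F i x))}"
  define \<L> where "\<L> = (\<Union>i\<in>I. {diag_lower (F i) i, diag_upper (F i) i})"
  have F: "\<phi> i = (\<lambda>x. Some (F i x))" if "i \<in> I" for i
    using that by (simp only: I_def mem_Collect_eq)
  have indices: "\<phi> (a i) x = Some (if x \<in> diag_lower (F i) i then 1 else 0)"
      "\<phi> (b i) x = Some (if x \<in> diag_upper (F i) i then 1 else 0)"
    if "i \<in> I" for i x
    by (simp_all only: pdiag_total[of \<phi> i "F i", OF F[OF that]] a(2) b(2))
  define h where "h x = plearner \<phi> z a b (code_input x)" for x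
  have "h \<in> partial_learners"
    unfolding partial_learners_def mem_Collect_eq
    by (intro exI[of _ "plearner \<phi> z a b"])
      (simp add: h_def partial_computable_plearner[OF \<phi> a(1) b(1)])
  moreover have "learns It (CIndEx_C \<phi>) h L" if L_in: "L \<in> \<L>" for L
  proof -
    obtain i where i: "i \<in> I" and L: "L = diag_lower (F i) i \<or> L = diag_upper (F i) i"
      using L_in unfolding \<L>_def by blast
    show ?thesis
    proof (rule switching_learner_learns)
      show "h Start = Some z" "h (Step e None) = Some e" for e
        by (simp_all add: h_def plearner_simps z)
      show "h (Step e (Some y)) =
          Some (if e = b i then b i else if y \<in> diag_lower (F i) i then a i else b i)"
        if "y \<in> diag_upper (F i) i" for e y
        unfolding h_def by (rule plearner_item[where f = "F i", of \<phi>, OF F[OF i] that])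
      show "C_index \<phi> z" "C_set \<phi> z = {}"
        by (rule C_index_characteristic[where A = "{}"]; simp add: z)+
      show "C_index \<phi> (a i)" "C_set \<phi> (a i) = diag_lower (F i) i"
        by (rule C_index_characteristic, rule indices[OF i])+
      show "C_index \<phi> (b i)" "C_set \<phi> (b i) = diag_upper (F i) i"
        by (rule C_index_characteristic, rule indices[OF i])+
    qed (fact diag_lower_subset diag_upper_nonempty L)+
  qed
  moreover have "\<L> \<subseteq> REC"
  proof
    fix L assume "L \<in> \<L>"
    then obtain i where i: "i \<in> I" and L: "L = diag_lower (F i) i \<or> L = diag_upper (F i) i"
      unfolding \<L>_def by blast
    have "\<phi> (a i) = (\<lambda>x. Some (if x \<in> diag_lower (F i) i then 1 else 0))"
      "\<phi> (b i) = (\<lambda>x. Some (if x \<in> diag_upper (F i) i then 1 else 0))"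
      by (rule ext, rule indices[OF i])+
    then have "\<exists>e. \<phi> e = (\<lambda>x. Some (if x \<in> L then 1 else 0))"
      using L by metis
    then have "(\<lambda>x. Some (if x \<in> L then 1 else 0)) \<in> range \<phi>" by (metis rangeI)
    then show "L \<in> REC"
      unfolding REC_def total_computable_def range by simp
  qed
  ultimately have "\<L> \<in> Txt_REC partial_learners It (CIndEx_C \<phi>)"
    unfolding Txt_REC_def by blast
  moreover have "\<L> \<notin> Txt_REC total_learners It (CIndEx_C \<phi>)"
  proof
    assume "\<L> \<in> Txt_REC total_learners It (CIndEx_C \<phi>)"
    then obtain g where g: "g \<in> total_learners" "\<And>L. L \<in> \<L> \<Longrightarrow> learns It (CIndEx_C \<phi>) g L"
      unfolding Txt_REC_def by blast
    from g(1) obtain \<psi> where \<psi>: "partial_computable \<psi>" "\<And>x. g x = \<psi> (code_input x)"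
      and total: "\<And>x. g x \<noteq> None"
      unfolding total_learners_def partial_learners_def by blast
    have "\<psi> \<in> range \<phi>" unfolding range using \<psi>(1) by simp
    then obtain i where i: "\<psi> = \<phi> i" by (rule rangeE)
    \<comment> \<open>Every number codes an input, so totality of the learner makes its program
      total on all numbers. Its own index \<open>i\<close> then contributes a pair of sets to
      \<open>\<L>\<close> on which it fails.\<close>
    have "\<phi> i x \<noteq> None" for x
      using \<psi>(2) total bij_code_input unfolding i by (metis bij_pointE)
    then have "i \<in> I" by (auto simp: I_def F_def)
    show False
    proof (rule total_learner_fails)
      show "g x = Some (F i (code_input x))" for x
        using total[of x] by (simp add: \<psi>(2) i F_def)
      show "learns It (CIndEx_C \<phi>) g (diag_lower (F i) i)"
        "learns It (CIndEx_C \<phi>) g (diag_upper (F i) i)"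
        using \<open>i \<in> I\<close> by (auto intro!: g(2) simp: \<L>_def)
    qed
  qed
  moreover have "Txt_REC total_learners It (CIndEx_C \<phi>) \<subseteq> Txt_REC partial_learners It (CIndEx_C \<phi>)"
    by (auto simp: Txt_REC_def total_learners_def)
  ultimately show ?thesis by blast
qed

end
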